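(* Let $G^s$ be a finite simple symmetric tree and let $q\geq 1$ be an integer with $2q=\max_{x\in V}v(x)$. Then for all $k=1,\dots,q$, $$\lambda_k(S_{G^s})\le 2,$$ and $$\lambda_{q+1}(S_{G^s})\le 2(q+1).$$
   Context: A directed graph $G=(V,\vec E)$ has finite vertex set $V$ and $\vec E\subset V\times V$ without loops. For $x\in V$, $V_x=\{y:(x,y)\in\vec E\text{ or }(y,x)\in\vec E\}$ and the valency is $v(x)=\#V_x$. A simple symmetric tree $G^s$: $(x,y)\in\vec E$ iff $(y,x)\in\vec E$, the underlying undirected graph is a tree, and the weights are all one, i.e. $m(x)=1$ for all $x\in V$, $b(x,y)=1$ if $(x,y)\in\vec E$ and $b(x,y)=0$ otherwise. The special Laplacian is $S_{G}f(x)=\frac1{m(x)}\sum_{y\in V_x}(b(x,y)+b(y,x))(f(x)-f(y))$, so here $S_{G^s}f(x)=2\sum_{y\in V_x}(f(x)-f(y))$. It is self-adjoint on functions $V\to\mathbb C$ with inner product $\sum_x m(x)f(x)\overline{g(x)}$, and its eigenvalues are listed in nondecreasing order with multiplicity: $\lambda_1\le\lambda_2\le\cdots$. *)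

theory Defs
  imports
    Complex_Main
    "HOL-Library.Multiset"
    "HOL-Library.Function_Algebras"
    "Graph_Theory.Digraph_Component"
begin

definition nbrs :: "'a pair_pre_digraph \<Rightarrow> 'a \<Rightarrow> 'a set" where
  "nbrs G x = {y. (x, y) \<in> parcs G \<or> (y, x) \<in> parcs G}"

definition valency :: "'a pair_pre_digraph \<Rightarrow> 'a \<Rightarrow> nat" where
  "valency G x = card (nbrs G x)"

(* pair_graph: finite vertex set, arcs are pairs of distinct vertices, and the arc set is
   symmetric. The library's predicate tree is not usable for a symmetric digraph: there the
   two arcs (x, y), (y, x) already form a cycle. In a symmetric digraph without loops, the
   cycles of the underlying undirected graph are the directed cycles of length at least 3.
   connected includes that the vertex set is nonempty. *)
definition symmetric_tree :: "'a pair_pre_digraph \<Rightarrow> bool" where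
  "symmetric_tree G \<longleftrightarrow>
     pair_graph G \<and> Digraph_Component.connected (with_proj G) \<and>
     (\<nexists>p. pre_digraph.cycle (with_proj G) p \<and> 3 \<le> length p)"

definition simple_symmetric_tree ::
  "'a pair_pre_digraph \<Rightarrow> ('a \<Rightarrow> real) \<Rightarrow> ('a \<Rightarrow> 'a \<Rightarrow> real) \<Rightarrow> bool" where
  "simple_symmetric_tree G m b \<longleftrightarrow>
     symmetric_tree G \<and>
     (\<forall>x\<in>pverts G. m x = 1) \<and>
     (\<forall>x\<in>pverts G. \<forall>y\<in>pverts G. b x y = (if (x, y) \<in> parcs G then 1 else 0))"

definition special_laplacian ::
  "'a pair_pre_digraph \<Rightarrow> ('a \<Rightarrow> real) \<Rightarrow> ('a \<Rightarrow> 'a \<Rightarrow> real) \<Rightarrow> ('a \<Rightarrow> complex) \<Rightarrow> 'a \<Rightarrow> complex" where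
  "special_laplacian G m b f x =
     complex_of_real (1 / m x) *
       (\<Sum>y\<in>nbrs G x. complex_of_real (b x y + b y x) * (f x - f y))"

(* A function V -> C is represented by its extension by zero to the whole type. *)
definition eigenspace ::
  "'a set \<Rightarrow> (('a \<Rightarrow> complex) \<Rightarrow> 'a \<Rightarrow> complex) \<Rightarrow> complex \<Rightarrow> ('a \<Rightarrow> complex) set" where
  "eigenspace V T \<mu> = {f. (\<forall>x. x \<notin> V \<longrightarrow> f x = 0) \<and> (\<forall>x\<in>V. T f x = \<mu> * f x)}"

definition multiplicity_of ::
  "'a set \<Rightarrow> (('a \<Rightarrow> complex) \<Rightarrow> 'a \<Rightarrow> complex) \<Rightarrow> complex \<Rightarrow> nat" where
  "multiplicity_of V T \<mu> =
     vector_space.dim (\<lambda>(c::complex) f x. c * f x) (eigenspace V T \<mu>)"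

(* Only used for self-adjoint T on a finite V: then there are finitely many eigenvalues, all of
   them real, the geometric multiplicity is the multiplicity, and the list below
   has length card V. *)
definition eigenvalue_list ::
  "'a set \<Rightarrow> (('a \<Rightarrow> complex) \<Rightarrow> 'a \<Rightarrow> complex) \<Rightarrow> real list" where
  "eigenvalue_list V T =
     sorted_list_of_multiset
       (\<Sum>\<mu> | \<exists>f\<in>eigenspace V T (complex_of_real \<mu>). f \<noteq> (\<lambda>_. 0).
          replicate_mset (multiplicity_of V T (complex_of_real \<mu>)) \<mu>)"

(* eigenvalues are numbered from 1 *)
definition special_eigenvalue ::
  "'a pair_pre_digraph \<Rightarrow> ('a \<Rightarrow> real) \<Rightarrow> ('a \<Rightarrow> 'a \<Rightarrow> real) \<Rightarrow> nat \<Rightarrow> real" where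
  "special_eigenvalue G m b k = eigenvalue_list (pverts G) (special_laplacian G m b) ! (k - 1)"

end

theory Submission
  imports Defs "HOL-Analysis.Function_Topology" "HOL-Analysis.Topology_Euclidean_Space"
begin

text \<open>Let \<open>x\<close> be a vertex of valency \<open>d\<close>. Removing \<open>x\<close> splits the tree into \<open>d\<close> branches, whose
  indicator functions span a \<open>d\<close>-dimensional space. On it the quadratic form of the Laplacian only
  sees the edges at \<open>x\<close>, so its Rayleigh quotient is at most \<open>2\<close>, and by the min-max principle the
  first \<open>d\<close> eigenvalues are at most \<open>2\<close>. With \<open>d = 2 * q\<close> this also covers the eigenvalue number
  \<open>q + 1\<close>.\<close>

section \<open>Underdetermined linear systems and sorted lists\<close>

text \<open>Gaussian elimination, one equation at a time: an unknown with nonzero coefficient in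
  equation \<open>b\<close> is expressed through the others, which leaves one equation and one
  unknown fewer.\<close>

lemma underdetermined_system:
  fixes a :: "'i \<Rightarrow> 'b \<Rightarrow> 'f::field"
  assumes "finite B" "finite I" "card B < card I"
  shows "\<exists>c. (\<exists>i\<in>I. c i \<noteq> 0) \<and> (\<forall>b\<in>B. (\<Sum>i\<in>I. c i * a i b) = 0)"
  using assms
proof (induction B arbitrary: I a rule: finite_induct)
  case empty
  then obtain i where "i \<in> I" by fastforce
  then show ?case by (auto intro!: exI[of _ "\<lambda>_. 1"])
next
  case (insert b B)
  show ?case
  proof (cases "\<forall>i\<in>I. a i b = 0")
    case True
    from insert.prems insert.hyps have "card B < card I" by simp
    from insert.IH[OF insert.prems(1) this, of a] obtain c where
      "\<exists>i\<in>I. c i \<noteq> 0" "\<forall>b\<in>B. (\<Sum>i\<in>I. c i * a i b) = 0" by blast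
    with True show ?thesis by (intro exI[of _ c]) simp
  next
    case False
    then obtain p where p: "p \<in> I" "a p b \<noteq> 0" by blast
    let ?J = "I - {p}"
    \<comment> \<open>Coefficients of the remaining equations after unknown \<open>p\<close> has
      been eliminated through equation \<open>b\<close>.\<close>
    let ?a' = "\<lambda>i b'. a i b' - a i b / a p b * a p b'"
    have "card B < card ?J" using insert.prems insert.hyps p by simp
    then obtain c where c: "\<exists>i\<in>?J. c i \<noteq> 0" "\<forall>b'\<in>B. (\<Sum>i\<in>?J. c i * ?a' i b') = 0"
      using insert.IH[of ?J ?a'] insert.prems(1) by blast
    \<comment> \<open>Equation \<open>b\<close> forces the value \<open>- s\<close> of unknown
      \<open>p\<close>.\<close>
    define s where "s = (\<Sum>i\<in>?J. c i * a i b) / a p b"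
    define c' where "c' = c(p := - s)"
    have split: "(\<Sum>i\<in>I. c' i * a i b') = (\<Sum>i\<in>?J. c i * a i b') - s * a p b'" for b'
    proof -
      have "(\<Sum>i\<in>I. c' i * a i b') = c' p * a p b' + (\<Sum>i\<in>?J. c' i * a i b')"
        using insert.prems(1) p(1) by (rule sum.remove)
      also have "(\<Sum>i\<in>?J. c' i * a i b') = (\<Sum>i\<in>?J. c i * a i b')"
        by (rule sum.cong) (auto simp: c'_def)
      finally show ?thesis by (simp add: c'_def)
    qed
    have "(\<Sum>i\<in>I. c' i * a i b') = 0" if "b' \<in> insert b B" for b'
    proof (cases "b' = b")
      case True
      then show ?thesis using p by (simp add: split s_def)
    next
      case False
      with that c(2) have "0 = (\<Sum>i\<in>?J. c i * ?a' i b')" by simp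
      also have "\<dots> = (\<Sum>i\<in>?J. c i * a i b') - (\<Sum>i\<in>?J. c i * (a i b / a p b * a p b'))"
        by (simp add: right_diff_distrib sum_subtractf)
      also have "(\<Sum>i\<in>?J. c i * (a i b / a p b * a p b')) = s * a p b'"
        by (simp add: s_def sum_distrib_right sum_divide_distrib mult.assoc)
      finally show ?thesis by (simp add: split)
    qed
    moreover have "\<exists>i\<in>I. c' i \<noteq> 0" using c(1) by (auto simp: c'_def)
    ultimately show ?thesis by blast
  qed
qed

text \<open>If entry \<open>k\<close> exceeded \<open>r\<close>, sortedness would confine the
  entries up to \<open>r\<close> to the \<open>k\<close> positions before it. This turns a count of
  small eigenvalues into a bound on a list entry.\<close>

lemma sorted_nth_le:
  fixes xs :: "'a::linorder list"
  assumes "sorted xs" "k < length (filter (\<lambda>x. x \<le> r) xs)"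
  shows "xs ! k \<le> r"
proof (rule ccontr)
  assume gt: "\<not> xs ! k \<le> r"
  have "i < k" if "i < length xs" "xs ! i \<le> r" for i
  proof (rule ccontr)
    assume "\<not> i < k"
    with assms(1) that(1) have "xs ! k \<le> xs ! i" by (simp add: sorted_nth_mono)
    with that gt show False by simp
  qed
  then have "card {i. i < length xs \<and> xs ! i \<le> r} \<le> card {..<k}"
    by (intro card_mono) auto
  with assms(2) show False by (simp add: length_filter_conv_card)
qed

section \<open>Functions supported on a finite set and their inner product\<close>

text \<open>The scalar multiplication of \<open>multiplicity_of\<close>, so that
  \<open>cfun.dim\<close> is the dimension occurring there.\<close>

interpretation cfun: vector_space "\<lambda>(c::complex) (f::'a \<Rightarrow> complex) x. c * f x"
  by unfold_locales (auto simp: algebra_simps fun_eq_iff)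

text \<open>The point indicators of \<open>V\<close> span all functions supported on
  \<open>V\<close>, so a basis of \<open>E\<close> is finite. This makes \<open>card B\<close> a
  genuine count, since infinite sets have cardinality 0.\<close>

lemma finite_dim_finite_support:
  assumes "finite V" "\<And>f x. f \<in> E \<Longrightarrow> x \<notin> V \<Longrightarrow> f x = 0"
  obtains B where "B \<subseteq> E" "finite B" "E \<subseteq> cfun.span B" "card B = cfun.dim E"
proof -
  obtain B where B: "B \<subseteq> E" "cfun.independent B" "E \<subseteq> cfun.span B" "card B = cfun.dim E"
    by (rule cfun.basis_exists)
  let ?e = "\<lambda>x y. if y = x then 1 else 0 :: complex"
  have "f \<in> cfun.span (?e ` V)" if "f \<in> E" for f
  proof -
    have "(\<Sum>x\<in>V. (\<lambda>y. f x * ?e x y)) \<in> cfun.span (?e ` V)"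
      by (intro cfun.span_sum cfun.span_scale cfun.span_base) auto
    moreover have "(\<Sum>x\<in>V. (\<lambda>y. f x * ?e x y)) = f"
    proof
      fix y
      \<comment> \<open>This is a sum in the function space; the induction moves the evaluation at
        \<open>y\<close> inside it.\<close>
      have "(\<Sum>x\<in>V. (\<lambda>y. f x * ?e x y)) y = (\<Sum>x\<in>V. f x * ?e x y)"
        using assms(1) by (induction V rule: finite_induct) auto
      also have "\<dots> = (\<Sum>x\<in>V. if x = y then f x else 0)" by (rule sum.cong) auto
      also have "\<dots> = f y" using assms that by auto
      finally show "(\<Sum>x\<in>V. (\<lambda>y. f x * ?e x y)) y = f y" .
    qed
    ultimately show ?thesis by simp
  qed
  with B(1) have "B \<subseteq> cfun.span (?e ` V)" by blast
  with B(2) assms(1) have "finite B" using cfun.independent_span_bound[of "?e ` V" B] by blast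
  with B that show ?thesis by blast
qed

text \<open>The inner product for weights equal to one: linear in the first argument,
  conjugate-linear in the second.\<close>

definition ip :: "'a set \<Rightarrow> ('a \<Rightarrow> complex) \<Rightarrow> ('a \<Rightarrow> complex) \<Rightarrow> complex" where
  "ip V f g = (\<Sum>x\<in>V. f x * cnj (g x))"

lemma ip_add_left: "ip V (\<lambda>x. f x + c * g x) h = ip V f h + c * ip V g h"
  by (simp add: ip_def sum_distrib_left sum.distrib algebra_simps)

lemma ip_add_right: "ip V h (\<lambda>x. f x + c * g x) = ip V h f + cnj c * ip V h g"
  by (simp add: ip_def sum_distrib_left sum.distrib algebra_simps)

lemma ip_scale_left: "ip V (\<lambda>x. c * g x) h = c * ip V g h"
  by (simp add: ip_def sum_distrib_left algebra_simps)

lemma ip_scale_right: "ip V h (\<lambda>x. c * g x) = cnj c * ip V h g"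
  by (simp add: ip_def sum_distrib_left algebra_simps)

lemma ip_sum_left: "ip V (\<lambda>x. \<Sum>i\<in>I. c i * u i x) h = (\<Sum>i\<in>I. c i * ip V (u i) h)"
  by (simp add: ip_def sum_distrib_left sum_distrib_right mult.assoc) (rule sum.swap)

lemma ip_self: "ip V f f = complex_of_real (\<Sum>x\<in>V. (cmod (f x))\<^sup>2)"
  by (simp add: ip_def complex_norm_square[symmetric])

lemma ip_self_eq_0_iff: "finite V \<Longrightarrow> ip V f f = 0 \<longleftrightarrow> (\<forall>x\<in>V. f x = 0)"
  unfolding ip_self of_real_eq_0_iff by (subst sum_nonneg_eq_0_iff) auto

lemma Re_ip_self_nonneg: "0 \<le> Re (ip V f f)"
  by (simp add: ip_self sum_nonneg)

lemma ip_self_Re: "ip V f f = complex_of_real (Re (ip V f f))"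
  by (simp add: ip_self)

lemma eigenspace_cong:
  assumes "\<And>f x. \<lbrakk>\<And>y. y \<notin> V \<Longrightarrow> f y = 0; x \<in> V\<rbrakk> \<Longrightarrow> S f x = T f x"
  shows "eigenspace V S \<mu> = eigenspace V T \<mu>"
  using assms by (auto simp: eigenspace_def)

section \<open>Eigenvalues of a Hermitian matrix\<close>

locale hermitian_matrix =
  fixes V :: "'a set" and A :: "'a \<Rightarrow> 'a \<Rightarrow> complex"
  assumes finite_V: "finite V"
    and hermitian: "\<And>x y. x \<in> V \<Longrightarrow> y \<in> V \<Longrightarrow> A y x = cnj (A x y)"
begin

text \<open>The value 0 outside \<open>V\<close> makes the image again the extension by zero of a
  function on \<open>V\<close>.\<close>

definition app :: "('a \<Rightarrow> complex) \<Rightarrow> 'a \<Rightarrow> complex" where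
  "app f x = (if x \<in> V then \<Sum>y\<in>V. A x y * f y else 0)"

lemma app_add: "app (\<lambda>x. f x + c * g x) x = app f x + c * app g x"
  by (simp add: app_def sum_distrib_left sum.distrib algebra_simps)

lemma app_scale: "app (\<lambda>x. c * g x) x = c * app g x"
  by (simp add: app_def sum_distrib_left algebra_simps)

lemma app_selfadjoint: "ip V (app f) g = ip V f (app g)"
proof -
  have "ip V (app f) g = (\<Sum>x\<in>V. \<Sum>y\<in>V. A x y * f y * cnj (g x))"
    by (simp add: ip_def app_def sum_distrib_right)
  also have "\<dots> = (\<Sum>y\<in>V. \<Sum>x\<in>V. A x y * f y * cnj (g x))" by (rule sum.swap)
  also have "\<dots> = (\<Sum>y\<in>V. \<Sum>x\<in>V. f y * cnj (A y x * g x))"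
  proof (intro sum.cong refl)
    fix x y assume "x \<in> V" "y \<in> V"
    then have "A x y = cnj (A y x)" by (rule hermitian[rotated])
    then show "A x y * f y * cnj (g x) = f y * cnj (A y x * g x)" by simp
  qed
  also have "\<dots> = ip V f (app g)"
    by (simp add: ip_def app_def sum_distrib_left)
  finally show ?thesis .
qed

lemma eigenvector_app: "g \<in> eigenspace V app \<mu> \<Longrightarrow> app g = (\<lambda>x. \<mu> * g x)"
  by (fastforce simp: eigenspace_def app_def)

text \<open>Self-adjointness equates \<open>\<mu> * ip V f g\<close> with
  \<open>\<nu> * ip V f g\<close>; the second value uses that \<open>\<nu>\<close> is real.\<close>

lemma eigenvectors_orthogonal:
  assumes "f \<in> eigenspace V app (complex_of_real \<mu>)" "g \<in> eigenspace V app (complex_of_real \<nu>)"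
    and "\<mu> \<noteq> \<nu>"
  shows "ip V f g = 0"
  using app_selfadjoint[of f g] assms(3)
  by (simp add: assms(1,2)[THEN eigenvector_app] ip_scale_left ip_scale_right)

definition eigenvalues :: "real set" where
  "eigenvalues = {\<mu>. \<exists>f\<in>eigenspace V app (complex_of_real \<mu>). f \<noteq> (\<lambda>_. 0)}"

lemma eigenvector_ip_nonzero:
  assumes "f \<in> eigenspace V app \<mu>" "f \<noteq> (\<lambda>_. 0)"
  shows "ip V f f \<noteq> 0"
  using assms finite_V by (auto simp: ip_self_eq_0_iff eigenspace_def fun_eq_iff)

text \<open>\<open>eigenvalue_list\<close> sums over this set, and a sum over an infinite set is 0
  by convention. Too many eigenvalues would give linearly dependent eigenvectors, against
  orthogonality.\<close>

lemma finite_eigenvalues: "finite eigenvalues"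
proof (rule ccontr)
  assume "infinite eigenvalues"
  then obtain I where I: "I \<subseteq> eigenvalues" "finite I" "card I = Suc (card V)"
    using infinite_arbitrarily_large by blast
  have "\<forall>\<mu>\<in>I. \<exists>f. f \<in> eigenspace V app (complex_of_real \<mu>) \<and> f \<noteq> (\<lambda>_. 0)"
    using I(1) unfolding eigenvalues_def by blast
  then obtain e where e: "\<forall>\<mu>\<in>I. e \<mu> \<in> eigenspace V app (complex_of_real \<mu>) \<and> e \<mu> \<noteq> (\<lambda>_. 0)"
    by (rule bchoice[THEN exE])
  \<comment> \<open>One unknown per eigenvector and one equation per point of
    \<open>V\<close>.\<close>
  obtain c where c: "\<exists>\<mu>\<in>I. c \<mu> \<noteq> 0" "\<forall>x\<in>V. (\<Sum>\<mu>\<in>I. c \<mu> * e \<mu> x) = 0"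
    using underdetermined_system[OF finite_V I(2), of e] I(3) by auto
  from c(1) obtain \<nu> where \<nu>: "\<nu> \<in> I" "c \<nu> \<noteq> 0" by blast
  \<comment> \<open>Pairing the vanishing combination with \<open>e \<nu>\<close> isolates the
    coefficient \<open>c \<nu>\<close>.\<close>
  have "0 = ip V (\<lambda>x. \<Sum>\<mu>\<in>I. c \<mu> * e \<mu> x) (e \<nu>)"
    using c(2) by (simp add: ip_def)
  also have "\<dots> = (\<Sum>\<mu>\<in>I. c \<mu> * ip V (e \<mu>) (e \<nu>))" by (rule ip_sum_left)
  also have "\<dots> = (\<Sum>\<mu>\<in>I. if \<mu> = \<nu> then c \<nu> * ip V (e \<nu>) (e \<nu>) else 0)"
    using e \<nu>(1) by (intro sum.cong refl) (auto dest: eigenvectors_orthogonal)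
  also have "\<dots> = c \<nu> * ip V (e \<nu>) (e \<nu>)" using I(2) \<nu>(1) by simp
  finally have "ip V (e \<nu>) (e \<nu>) = 0" using \<nu>(2) by simp
  moreover have "ip V (e \<nu>) (e \<nu>) \<noteq> 0" using e \<nu>(1) by (intro eigenvector_ip_nonzero) auto
  ultimately show False by contradiction
qed

text \<open>In the product topology the set is closed and lies in a product of unit discs and
  singletons, which is compact by Tychonoff.\<close>

lemma compact_unit_sphere_orthogonal:
  "compact {f. (\<forall>x. x \<notin> V \<longrightarrow> f x = 0) \<and> (\<forall>b\<in>B. ip V f b = 0) \<and> ip V f f = 1}" (is "compact ?K")
proof -
  let ?C = "PiE UNIV (\<lambda>x. if x \<in> V then cball (0::complex) 1 else {0})"
  have "compactin (product_topology (\<lambda>_. euclidean) UNIV) ?C"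
    unfolding compactin_PiE by (intro disjI2 ballI) simp
  then have "compact ?C" by (simp add: euclidean_product_topology)
  moreover have "closed ?K"
  proof -
    have coord: "continuous_on UNIV (\<lambda>f::'a \<Rightarrow> complex. f x)" for x
      by (rule continuous_on_product_coordinates)
    have "closed {f::'a \<Rightarrow> complex. f x = 0}" for x
      by (intro closed_Collect_eq coord continuous_on_const)
    moreover have "closed {f. ip V f h = 0}" for h
      unfolding ip_def
      by (intro closed_Collect_eq continuous_on_sum continuous_on_mult coord continuous_on_const)
    moreover have "closed {f. ip V f f = 1}"
      unfolding ip_def
      by (intro closed_Collect_eq continuous_on_sum continuous_on_mult continuous_on_cnj coord
          continuous_on_const)
    ultimately have "closed ((\<Inter>x\<in>-V. {f. f x = 0}) \<inter> (\<Inter>b\<in>B. {f. ip V f b = 0}) \<inter> {f. ip V f f = 1})"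
      by (intro closed_Int closed_INT) auto
    also have "(\<Inter>x\<in>-V. {f. f x = 0}) \<inter> (\<Inter>b\<in>B. {f. ip V f b = 0}) \<inter> {f. ip V f f = 1} = ?K" by auto
    finally show ?thesis .
  qed
  moreover have "?K \<subseteq> ?C"
  proof -
    have "cmod (f x) \<le> 1" if "ip V f f = 1" "x \<in> V" for f x
    proof -
      have "(cmod (f x))\<^sup>2 \<le> (\<Sum>x\<in>V. (cmod (f x))\<^sup>2)"
        using that finite_V by (intro member_le_sum) auto
      also have "\<dots> = 1" using that(1) by (metis ip_self of_real_eq_1_iff)
      finally show ?thesis by (simp add: abs_square_le_1)
    qed
    then show ?thesis by (auto simp: PiE_iff)
  qed
  ultimately show ?thesis using compact_Int_closed[of ?C ?K] by (simp add: Int_absorb1)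
qed

text \<open>The polynomial has its minimum at \<open>t = 0\<close>, so its derivative
  \<open>2 * N\<close> there vanishes.\<close>

lemma nonneg_quadratic_imp_zero:
  fixes N c :: real
  assumes "\<And>t. 0 \<le> 2 * t * N + t\<^sup>2 * c"
  shows "N = 0"
proof (cases "c = 0")
  case True
  with assms[of 1] assms[of "-1"] show ?thesis by simp
next
  case False
  \<comment> \<open>The vertex of the parabola.\<close>
  have "0 \<le> 2 * (- N / c) * N + (- N / c)\<^sup>2 * c" by (rule assms)
  also have "\<dots> = - (N\<^sup>2 / c)" using False by (simp add: power2_eq_square)
  finally have 1: "N\<^sup>2 / c \<le> 0" by simp
  have "c \<ge> 0" using assms[of 1] assms[of "-1"] by simp
  with False have "c > 0" by simp
  with 1 show ?thesis by (simp add: divide_le_0_iff)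
qed

text \<open>A minimizer \<open>g\<close> of the Rayleigh quotient on the orthogonal complement of
  \<open>B\<close> is an eigenvector: the complement is invariant because \<open>B\<close> consists
  of eigenvectors, so the residual \<open>app g - \<mu> * g\<close> is itself an admissible
  direction of variation. Comparison with \<open>f\<close> gives
  \<open>\<mu> \<le> r\<close>.\<close>

lemma exists_orthogonal_eigenvector:
  assumes B: "\<And>b. b \<in> B \<Longrightarrow> \<exists>\<nu>. b \<in> eigenspace V app \<nu>"
    and f: "\<And>x. x \<notin> V \<Longrightarrow> f x = 0" "\<And>b. b \<in> B \<Longrightarrow> ip V f b = 0" "f \<noteq> (\<lambda>_. 0)"
    and r: "Re (ip V (app f) f) \<le> r * Re (ip V f f)"
  obtains \<mu> g where "\<mu> \<le> r" "g \<in> eigenspace V app (complex_of_real \<mu>)" "g \<noteq> (\<lambda>_. 0)"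
    "\<And>b. b \<in> B \<Longrightarrow> ip V g b = 0"
proof -
  let ?P = "\<lambda>f. (\<forall>x. x \<notin> V \<longrightarrow> f x = 0) \<and> (\<forall>b\<in>B. ip V f b = 0)"
  let ?K = "{f. (\<forall>x. x \<notin> V \<longrightarrow> f x = 0) \<and> (\<forall>b\<in>B. ip V f b = 0) \<and> ip V f f = 1}"
  let ?R = "\<lambda>f. Re (ip V (app f) f)"
  have normalize: "\<exists>c>0. (\<lambda>x. complex_of_real c * h x) \<in> ?K \<and> c\<^sup>2 * Re (ip V h h) = 1"
    if h: "?P h" "h \<noteq> (\<lambda>_. 0)" for h
  proof -
    from h finite_V have "ip V h h \<noteq> 0" by (auto simp: ip_self_eq_0_iff fun_eq_iff)
    then have pos: "Re (ip V h h) > 0"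
      using Re_ip_self_nonneg[of V h] by (metis ip_self_Re less_eq_real_def of_real_0)
    define c where "c = 1 / sqrt (Re (ip V h h))"
    have c: "c > 0" "c\<^sup>2 * Re (ip V h h) = 1"
      using pos by (simp_all add: c_def power_divide)
    have "ip V (\<lambda>x. complex_of_real c * h x) (\<lambda>x. complex_of_real c * h x)
        = complex_of_real (c\<^sup>2 * Re (ip V h h))"
      by (subst ip_scale_left, subst ip_scale_right, subst ip_self_Re)
        (simp add: power2_eq_square)
    with h(1) c show ?thesis by (intro exI[of _ c]) (simp add: ip_scale_left)
  qed
  have R_scale: "?R (\<lambda>x. complex_of_real c * h x) = c\<^sup>2 * ?R h" for c h
    by (simp add: app_scale[abs_def] ip_scale_left ip_scale_right power2_eq_square mult.assoc)
  have "continuous_on ?K ?R"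
  proof -
    have coord: "continuous_on ?K (\<lambda>f::'a \<Rightarrow> complex. f x)" for x
      by (rule continuous_on_subset[OF continuous_on_product_coordinates]) simp
    have "continuous_on ?K (\<lambda>f. Re (\<Sum>x\<in>V. (\<Sum>y\<in>V. A x y * f y) * cnj (f x)))"
      by (intro continuous_on_Re continuous_on_sum continuous_on_mult continuous_on_cnj coord
          continuous_on_const)
    also have "(\<lambda>f. Re (\<Sum>x\<in>V. (\<Sum>y\<in>V. A x y * f y) * cnj (f x))) = ?R"
      unfolding ip_def app_def by (intro ext arg_cong[of _ _ Re] sum.cong refl) simp
    finally show ?thesis .
  qed
  moreover have "?K \<noteq> {}"
  proof -
    have "?P f" using f by simp
    from normalize[OF this f(3)] obtain c :: real where "(\<lambda>x. complex_of_real c * f x) \<in> ?K"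
      by (elim exE conjE)
    then show ?thesis by (rule ex_in_conv[THEN iffD1, OF exI])
  qed
  ultimately have "\<exists>g\<in>?K. \<forall>h\<in>?K. ?R g \<le> ?R h"
    by (intro continuous_attains_inf compact_unit_sphere_orthogonal)
  then obtain g where g: "g \<in> ?K" and g_min: "\<forall>h\<in>?K. ?R g \<le> ?R h" by (rule bexE)
  define \<mu> where "\<mu> = ?R g"
  \<comment> \<open>By homogeneity the minimum on the unit sphere bounds the form on the whole
    complement.\<close>
  have low: "\<mu> * Re (ip V h h) \<le> ?R h" if h: "?P h" for h
  proof (cases "h = (\<lambda>_. 0)")
    case True
    then show ?thesis by (simp add: ip_def)
  next
    case False
    from normalize[OF h False] obtain c where
      c: "c > 0" "(\<lambda>x. complex_of_real c * h x) \<in> ?K" "c\<^sup>2 * Re (ip V h h) = 1" by blast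
    have "\<mu> * (c\<^sup>2 * Re (ip V h h)) \<le> c\<^sup>2 * ?R h"
      using bspec[OF g_min c(2)] by (simp only: R_scale c(3) \<mu>_def mult_1_right)
    then have "c\<^sup>2 * (\<mu> * Re (ip V h h)) \<le> c\<^sup>2 * ?R h" by (simp add: algebra_simps)
    then show ?thesis using c(1) by (simp add: mult_le_cancel_left)
  qed
  have "\<mu> * Re (ip V f f) \<le> r * Re (ip V f f)" using low[of f] f r by force
  moreover have "Re (ip V f f) > 0"
    using normalize[of f] f by (metis Re_ip_self_nonneg less_eq_real_def mult_zero_right zero_neq_one)
  ultimately have "\<mu> \<le> r" by simp
  \<comment> \<open>By \<open>low\<close> the form of the shifted operator is nonnegative on the
    complement, and it vanishes at \<open>g\<close>.\<close>
  define M where "M h x = app h x + complex_of_real (- \<mu>) * h x" for h x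
  have M_add: "M (\<lambda>x. h x + c * k x) = (\<lambda>x. M h x + c * M k x)" for h c k
    by (simp add: M_def app_add algebra_simps fun_eq_iff)
  have M_adj: "ip V (M h) k = ip V h (M k)" for h k
    unfolding M_def ip_add_left ip_add_right app_selfadjoint by simp
  have M_low: "0 \<le> Re (ip V (M h) h)" if "?P h" for h
    using low[OF that] unfolding M_def ip_add_left by simp
  define w where "w = M g"
  have "ip V w b = 0" if "b \<in> B" for b
  proof -
    from B[OF that] obtain \<nu> where "b \<in> eigenspace V app \<nu>" by blast
    then have "app b = (\<lambda>x. \<nu> * b x)" by (rule eigenvector_app)
    with g that show ?thesis
      unfolding w_def M_def ip_add_left app_selfadjoint by (simp add: ip_scale_right)
  qed
  then have Pw: "?P w" using g by (simp add: w_def M_def app_def)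
  \<comment> \<open>The form of \<open>M\<close> along \<open>g + t * w\<close>: its constant term
    is 0, and its linear coefficient is twice the squared norm of the residual.\<close>
  have "0 \<le> 2 * t * Re (ip V w w) + t\<^sup>2 * Re (ip V (M w) w)" for t :: real
  proof -
    let ?h = "\<lambda>x. g x + complex_of_real t * w x"
    have "?P ?h" using g Pw by (simp add: ip_add_left)
    then have "0 \<le> Re (ip V (M ?h) ?h)" by (rule M_low)
    also have "ip V (M ?h) ?h = ip V w g + complex_of_real t * ip V w w
        + complex_of_real t * (ip V w w + complex_of_real t * ip V (M w) w)"
      unfolding M_add ip_add_left ip_add_right M_adj[of w g] by (simp add: w_def)
    finally have "0 \<le> Re (ip V w g) + 2 * t * Re (ip V w w) + t\<^sup>2 * Re (ip V (M w) w)"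
      by (simp add: power2_eq_square algebra_simps)
    \<comment> \<open>Holds because \<open>g\<close> has norm one and \<open>\<mu>\<close> is the
      value of the form at \<open>g\<close>.\<close>
    moreover have "Re (ip V w g) = 0"
      using g unfolding w_def M_def ip_add_left by (simp add: \<mu>_def)
    ultimately show ?thesis by simp
  qed
  then have "Re (ip V w w) = 0" by (rule nonneg_quadratic_imp_zero)
  then have "\<forall>x\<in>V. w x = 0" using finite_V by (metis ip_self_Re ip_self_eq_0_iff of_real_0)
  then have "g \<in> eigenspace V app (complex_of_real \<mu>)"
    using g by (auto simp: eigenspace_def w_def M_def)
  moreover have "g \<noteq> (\<lambda>_. 0)" using g by (auto simp: ip_def)
  ultimately show ?thesis using that[OF \<open>\<mu> \<le> r\<close>] g by blast
qed

lemma eigenvalue_list_app: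
  "eigenvalue_list V app = sorted_list_of_multiset
     (\<Sum>\<mu>\<in>eigenvalues. replicate_mset (multiplicity_of V app (complex_of_real \<mu>)) \<mu>)"
  by (simp add: eigenvalue_list_def eigenvalues_def)

text \<open>If fewer than \<open>card I\<close> eigenvalues were at most \<open>r\<close>, a nonzero combination of the \<open>u i\<close> would be
  orthogonal to all their eigenvectors, and minimizing the Rayleigh quotient on that orthogonal
  complement would produce one more such eigenvector.\<close>

lemma eigenvalue_list_le:
  fixes u :: "'i \<Rightarrow> 'a \<Rightarrow> complex"
  assumes I: "finite I" "k < card I"
    and u: "\<And>i x. i \<in> I \<Longrightarrow> x \<notin> V \<Longrightarrow> u i x = 0"
    and indep: "\<And>c i. \<lbrakk>\<And>x. x \<in> V \<Longrightarrow> (\<Sum>i\<in>I. c i * u i x) = 0; i \<in> I\<rbrakk> \<Longrightarrow> c i = 0"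
    and r: "\<And>c f. f = (\<lambda>x. \<Sum>i\<in>I. c i * u i x) \<Longrightarrow> Re (ip V (app f) f) \<le> r * Re (ip V f f)"
  shows "eigenvalue_list V app ! k \<le> r"
proof -
  let ?E = "\<lambda>\<mu>. eigenspace V app (complex_of_real \<mu>)"
  let ?L = "{\<mu>\<in>eigenvalues. \<mu> \<le> r}"
  \<comment> \<open>A basis of each eigenspace; its size is the multiplicity.\<close>
  have "\<exists>B. B \<subseteq> ?E \<mu> \<and> finite B \<and> ?E \<mu> \<subseteq> cfun.span B \<and> card B = cfun.dim (?E \<mu>)" for \<mu>
    using finite_dim_finite_support[OF finite_V, of "?E \<mu>"] by (force simp: eigenspace_def)
  then obtain B where B: "B \<mu> \<subseteq> ?E \<mu>" "finite (B \<mu>)" "?E \<mu> \<subseteq> cfun.span (B \<mu>)"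
    "card (B \<mu>) = cfun.dim (?E \<mu>)" for \<mu> by metis
  let ?B = "\<Union>\<mu>\<in>?L. B \<mu>"
  have fin: "finite ?L" using finite_eigenvalues by simp
  have "card I \<le> card ?B"
  proof (rule ccontr)
    assume "\<not> card I \<le> card ?B"
    \<comment> \<open>The unknowns are the coefficients of the \<open>u i\<close>; each vector of
      \<open>?B\<close> contributes one orthogonality condition.\<close>
    then obtain c where c: "\<exists>i\<in>I. c i \<noteq> 0" "\<forall>b\<in>?B. (\<Sum>i\<in>I. c i * ip V (u i) b) = 0"
      using underdetermined_system[of ?B I "\<lambda>i b. ip V (u i) b"] I(1) B(2) fin by auto
    define f where "f = (\<lambda>x. \<Sum>i\<in>I. c i * u i x)"
    have "f x = 0" if "x \<notin> V" for x using u that by (simp add: f_def)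
    moreover have "ip V f b = 0" if "b \<in> ?B" for b
      unfolding f_def ip_sum_left using c(2) that by blast
    moreover have "f \<noteq> (\<lambda>_. 0)" using c(1) indep[of c] by (auto simp: f_def fun_eq_iff)
    moreover have "\<exists>\<nu>. b \<in> eigenspace V app \<nu>" if "b \<in> ?B" for b using that B(1) by blast
    ultimately obtain \<mu> g where g: "\<mu> \<le> r" "g \<in> ?E \<mu>" "g \<noteq> (\<lambda>_. 0)"
      "\<And>b. b \<in> ?B \<Longrightarrow> ip V g b = 0"
      using exists_orthogonal_eigenvector[of ?B f r] r[OF f_def] by blast
    then have "\<mu> \<in> ?L" by (auto simp: eigenvalues_def)
    \<comment> \<open>Orthogonality passes from the basis to its span, which contains
      \<open>g\<close> itself.\<close>
    have "ip V g h = 0" if "h \<in> cfun.span (B \<mu>)" for h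
      using that
    proof (induction rule: cfun.span_induct_alt)
      case base
      then show ?case by (simp add: ip_def)
    next
      case (step c b h)
      then have "ip V g b = 0" using g(4) \<open>\<mu> \<in> ?L\<close> by blast
      with step ip_add_right[of V g h c b] show ?case
        by (simp add: plus_fun_def add.commute)
    qed
    with g(2) B(3) have "ip V g g = 0" by blast
    with eigenvector_ip_nonzero g show False by blast
  qed
  also have "card ?B \<le> (\<Sum>\<mu>\<in>?L. card (B \<mu>))" using fin by (rule card_UN_le)
  also have "\<dots> = (\<Sum>\<mu>\<in>?L. multiplicity_of V app (complex_of_real \<mu>))"
    by (simp add: B(4) multiplicity_of_def)
  \<comment> \<open>Each eigenvalue occurs in the list as often as its multiplicity, so the sum
    counts the entries up to \<open>r\<close>.\<close>
  also have "\<dots> = length (filter (\<lambda>x. x \<le> r) (eigenvalue_list V app))" (is "_ = length ?F")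
  proof -
    let ?m = "\<lambda>\<mu>. multiplicity_of V app (complex_of_real \<mu>)"
    have filter_replicate: "filter_mset (\<lambda>x. x \<le> r) (replicate_mset n \<mu>)
        = (if \<mu> \<le> r then replicate_mset n \<mu> else {#})" for n \<mu>
      by (induction n) auto
    have "length ?F = size (mset ?F)" by (rule size_mset[symmetric])
    also have "mset ?F = filter_mset (\<lambda>x. x \<le> r) (\<Sum>\<mu>\<in>eigenvalues. replicate_mset (?m \<mu>) \<mu>)"
      by (simp add: eigenvalue_list_app)
    also have "\<dots> = (\<Sum>\<mu>\<in>eigenvalues. filter_mset (\<lambda>x. x \<le> r) (replicate_mset (?m \<mu>) \<mu>))"
      using finite_eigenvalues by (induction rule: finite_induct) auto
    also have "size \<dots> = (\<Sum>\<mu>\<in>eigenvalues. size (filter_mset (\<lambda>x. x \<le> r) (replicate_mset (?m \<mu>) \<mu>)))"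
      using finite_eigenvalues by (induction rule: finite_induct) auto
    also have "\<dots> = (\<Sum>\<mu>\<in>eigenvalues. if \<mu> \<le> r then ?m \<mu> else 0)"
      by (intro sum.cong) (simp_all add: filter_replicate)
    also have "\<dots> = (\<Sum>\<mu>\<in>?L. ?m \<mu>)"
      using finite_eigenvalues by (simp add: sum.inter_filter)
    finally show ?thesis by simp
  qed
  finally have "k < length ?F" using I(2) by linarith
  then show ?thesis
    by (intro sorted_nth_le) (simp_all add: eigenvalue_list_app)
qed

end

lemma eigenvalue_list_cong:
  assumes "\<And>f x. \<lbrakk>\<And>y. y \<notin> V \<Longrightarrow> f y = 0; x \<in> V\<rbrakk> \<Longrightarrow> S f x = T f x"
  shows "eigenvalue_list V S = eigenvalue_list V T"
  using eigenspace_cong[of V S T] assms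
  by (simp add: eigenvalue_list_def multiplicity_of_def)

section \<open>Branches of a tree at a vertex\<close>

text \<open>The arcs left after deleting \<open>x\<close>; in the reflexive transitive closure, the
  vertices related to a neighbour of \<open>x\<close> form its branch.\<close>

definition avoiding :: "'a pair_pre_digraph \<Rightarrow> 'a \<Rightarrow> 'a rel" where
  "avoiding G x = {(u, v) \<in> parcs G. u \<noteq> x \<and> v \<noteq> x}"

lemma avoiding_rtrancl_imp_apath:
  assumes "pair_wf_digraph G" and yz: "(y, z) \<in> (avoiding G x)\<^sup>*" and y: "y \<in> pverts G" "y \<noteq> x"
  obtains p where "pre_digraph.apath (with_proj G) y p z" "x \<notin> set (pawalk_verts y p)"
proof -
  interpret G: pair_wf_digraph G by fact
  \<comment> \<open>The graph with \<open>x\<close> deleted: its walks miss \<open>x\<close>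
    automatically, and they are walks of \<open>G\<close>.\<close>
  let ?H = "\<lparr>pverts = pverts G - {x}, parcs = avoiding G x\<rparr>"
  interpret H: pair_wf_digraph ?H
    by unfold_locales (auto simp: avoiding_def dest: G.wellformed')
  from yz y have "\<exists>p. H.awalk y p z"
  proof (induction rule: converse_rtrancl_induct)
    case base
    then show ?case by (auto intro!: exI[of _ "[]"] simp: H.awalk_Nil_iff)
  next
    case (step u v)
    then have "v \<in> pverts G" "v \<noteq> x" by (auto simp: avoiding_def dest: G.wellformed')
    with step obtain p where "H.awalk v p z" by blast
    with step.hyps(1) have "H.awalk u ((u, v) # p) z" by (simp add: H.awalk_Cons_iff)
    then show ?case by blast
  qed
  then obtain p where p: "H.apath y p z" using H.apath_awalk_to_apath by blast
  then have w: "H.awalk y p z" "distinct (pawalk_verts y p)" by (simp_all add: H.apath_def)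
  have "set (pawalk_verts y p) \<subseteq> pverts G - {x}"
    by (rule H.awalkE[OF w(1)]) simp
  moreover from w(1) have "G.awalk y p z" 
    by (auto simp: pre_digraph.awalk_def cas_with_proj_eq avoiding_def)
  with w(2) have "G.apath y p z" by (simp add: G.apath_def)
  ultimately show ?thesis using that by blast
qed

text \<open>A path joining two neighbours off \<open>x\<close> would close up through
  \<open>x\<close> to a cycle.\<close>

lemma avoiding_separates_neighbours:
  assumes "pair_graph G" and acyclic: "\<nexists>p. pre_digraph.cycle (with_proj G) p \<and> 3 \<le> length p"
    and "y \<in> nbrs G x" "y' \<in> nbrs G x" "y \<noteq> y'"
  shows "(y, y') \<notin> (avoiding G x)\<^sup>*"
proof
  assume r: "(y, y') \<in> (avoiding G x)\<^sup>*"
  interpret pair_graph G by fact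
  have arcs: "(x, y) \<in> parcs G" "(y', x) \<in> parcs G"
    using assms(3,4) arcs_symmetric by (auto simp: nbrs_def)
  then have "y \<in> pverts G" "y \<noteq> x" by (auto dest: wellformed' no_loops')
  then obtain p where p: "apath y p y'" "x \<notin> set (pawalk_verts y p)"
    using avoiding_rtrancl_imp_apath[OF pair_wf_digraph r] by blast
  let ?c = "(x, y) # p @ [(y', x)]"
  from p(1) have w: "awalk y p y'" "distinct (pawalk_verts y p)" by (simp_all add: apath_def)
  then have last: "last (pawalk_verts y p) = y'" by (auto dest: awalkE)
  have "awalk y' [(y', x)] x"
    using arcs by (auto simp: awalk_Cons_iff awalk_Nil_iff dest: wellformed')
  with w(1) have cw: "awalk y (p @ [(y', x)]) x" by (rule awalk_appendI)
  then have "awalk x ?c x"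
    using arcs by (auto simp: awalk_Cons_iff simp del: awalk_append_iff dest: wellformed')
  moreover have "pawalk_verts y (p @ [(y', x)]) = pawalk_verts y p @ [x]"
    using awalk_verts_append[OF cw] last by simp
  \<comment> \<open>The tail drops the starting point \<open>x\<close>, which recurs at the end of
    the closed walk.\<close>
  then have "distinct (tl (pawalk_verts x ?c))" using w(2) p(2) by simp
  ultimately have "cycle ?c" unfolding cycle_def by blast
  \<comment> \<open>The path has an arc because \<open>y\<close> and \<open>y'\<close> differ; with
    the two arcs at \<open>x\<close> this makes three.\<close>
  moreover have "p \<noteq> []" using w(1) assms(5) by (auto simp: awalk_Nil_iff)
  then have "3 \<le> length ?c" by (cases p) auto
  ultimately show False using acyclic by blast
qed

section \<open>The Laplacian on combinations of branch indicators\<close>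

text \<open>Pointwise form of the Rayleigh bound. For \<open>z\<close> other than \<open>x\<close>
  only the term \<open>w = x\<close> survives, contributing \<open>2 * f z\<close> when
  \<open>z\<close> is adjacent to \<open>x\<close>; at \<open>x\<close> the factor
  \<open>cnj (f x)\<close> vanishes.\<close>

lemma laplacian_mult_self_le:
  assumes "pair_graph G" and fx: "f x = 0"
    and f: "\<And>z w. (z, w) \<in> avoiding G x \<Longrightarrow> f z = f w"
  shows "Re ((\<Sum>w\<in>nbrs G z. 2 * (f z - f w)) * cnj (f z)) \<le> 2 * Re (f z * cnj (f z))"
proof (cases "z = x")
  case True
  then show ?thesis by (simp add: fx)
next
  case False
  interpret pair_graph G by fact
  have fin: "finite (nbrs G z)"
    by (rule finite_subset[OF _ pair_finite_verts]) (auto simp: nbrs_def dest: wellformed')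
  have "(\<Sum>w\<in>nbrs G z. 2 * (f z - f w)) = (\<Sum>w\<in>nbrs G z. if w = x then 2 * f z else 0)"
  proof (rule sum.cong[OF refl])
    fix w assume "w \<in> nbrs G z"
    then have "w \<noteq> x \<Longrightarrow> (z, w) \<in> avoiding G x"
      using False arcs_symmetric by (auto simp: avoiding_def nbrs_def)
    then show "2 * (f z - f w) = (if w = x then 2 * f z else 0)"
      using f[of z w] fx by auto
  qed
  also have "\<dots> = (if x \<in> nbrs G z then 2 * f z else 0)" using fin by simp
  finally show ?thesis by (auto simp: mult.assoc)
qed

lemma special_eigenvalue_le_2:
  assumes tree: "simple_symmetric_tree G m b" and x: "x \<in> pverts G"
    and k: "1 \<le> k" "k \<le> valency G x"
  shows "special_eigenvalue G m b k \<le> 2"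
proof -
  let ?V = "pverts G" and ?N = "nbrs G"
  have G: "pair_graph G" and acyclic: "\<nexists>p. pre_digraph.cycle (with_proj G) p \<and> 3 \<le> length p"
    and m: "\<And>u. u \<in> ?V \<Longrightarrow> m u = 1"
    and b: "\<And>u v. u \<in> ?V \<Longrightarrow> v \<in> ?V \<Longrightarrow> b u v = (if (u, v) \<in> parcs G then 1 else 0)"
    using tree by (auto simp: simple_symmetric_tree_def symmetric_tree_def)
  interpret pair_graph G by (rule G)
  have N: "?N u \<subseteq> ?V" "finite (?N u)" for u
  proof -
    show "?N u \<subseteq> ?V" by (auto simp: nbrs_def dest: wellformed')
    then show "finite (?N u)" by (rule finite_subset[OF _ pair_finite_verts])
  qed
  \<comment> \<open>Twice the degree matrix minus twice the adjacency matrix; the factor 2 is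
    \<open>b u v + b v u\<close> on an edge.\<close>
  define A :: "'a \<Rightarrow> 'a \<Rightarrow> complex" where
    "A u v = (if u = v then 2 * of_nat (card (?N u)) else 0) + (if v \<in> ?N u then - 2 else 0)" for u v
  interpret H: hermitian_matrix ?V A
    by unfold_locales (auto simp: A_def nbrs_def pair_finite_verts)
  have app: "H.app f u = (\<Sum>w\<in>?N u. 2 * (f u - f w))" if "u \<in> ?V" for f u
  proof -
    have "H.app f u = (\<Sum>v\<in>?V. A u v * f v)" using that by (simp add: H.app_def)
    also have "\<dots> = (\<Sum>v\<in>?V. if u = v then 2 * of_nat (card (?N u)) * f v else 0)
        + (\<Sum>v\<in>?V. if v \<in> ?N u then - 2 * f v else 0)"
      unfolding A_def distrib_right sum.distrib
      by (intro arg_cong2[where f = "(+)"] sum.cong refl) auto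
    also have "(\<Sum>v\<in>?V. if v \<in> ?N u then - 2 * f v else 0) = (\<Sum>v\<in>?N u. - 2 * f v)"
      using N(1)[of u] by (simp add: sum.inter_restrict[OF pair_finite_verts, symmetric] Int_absorb1)
    also have "(\<Sum>v\<in>?V. if u = v then 2 * of_nat (card (?N u)) * f v else 0)
        = 2 * of_nat (card (?N u)) * f u"
      using that pair_finite_verts by simp
    finally show ?thesis
      by (simp add: right_diff_distrib sum_subtractf sum_negf)
  qed
  have "special_laplacian G m b f u = H.app f u" if "u \<in> ?V" for f u
  proof -
    have "b u v + b v u = 2" if "v \<in> ?N u" for v
      using that b \<open>u \<in> ?V\<close> N(1)[of u] arcs_symmetric by (auto simp: nbrs_def)
    then show ?thesis using that by (simp add: special_laplacian_def app m)
  qed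
  then have list: "eigenvalue_list ?V (special_laplacian G m b) = eigenvalue_list ?V H.app"
    by (intro eigenvalue_list_cong)
  let ?R = "avoiding G x"
  \<comment> \<open>For a neighbour \<open>y\<close> of \<open>x\<close>, \<open>u y\<close> is the
    indicator of the branch containing \<open>y\<close>.\<close>
  define u :: "'a \<Rightarrow> 'a \<Rightarrow> complex" where "u y z = (if (y, z) \<in> ?R\<^sup>* then 1 else 0)" for y z
  have symR: "sym (?R\<^sup>*)"
    by (intro sym_rtrancl symI) (auto simp: avoiding_def arcs_symmetric)
  \<comment> \<open>The reflexive closure relates \<open>x\<close> to itself, so the start has to be
    a neighbour of \<open>x\<close>.\<close>
  have reach: "z \<in> ?V \<and> z \<noteq> x" if "(y, z) \<in> ?R\<^sup>*" "y \<in> ?N x" for y z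
    using that
  proof (induction rule: rtrancl_induct)
    case base
    then show ?case using N(1)[of x] by (auto simp: nbrs_def dest: no_loops')
  next
    case (step z w)
    then show ?case by (auto simp: avoiding_def dest: wellformed')
  qed
  have "eigenvalue_list ?V H.app ! (k - 1) \<le> 2"
  proof (rule H.eigenvalue_list_le[where I = "?N x" and u = u])
    show "finite (?N x)" by (rule N(2))
    show "k - 1 < card (?N x)" using k by (simp add: valency_def)
  next
    fix y z assume "y \<in> ?N x" "z \<notin> ?V"
    then show "u y z = 0" using reach by (auto simp: u_def)
  next
    fix c y
    assume c: "\<And>z. z \<in> ?V \<Longrightarrow> (\<Sum>y\<in>?N x. c y * u y z) = 0" and y: "y \<in> ?N x"
    \<comment> \<open>Distinct neighbours lie in distinct branches, so evaluation at
      \<open>y\<close> isolates \<open>c y\<close>.\<close>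
    have "(\<Sum>y'\<in>?N x. c y' * u y' y) = (\<Sum>y'\<in>?N x. if y' = y then c y else 0)"
      using avoiding_separates_neighbours[OF G acyclic _ y]
      by (intro sum.cong refl) (auto simp: u_def)
    also have "\<dots> = c y" using y N(2) by simp
    finally show "c y = 0" using c[of y] y N(1) by auto
  next
    fix c f
    assume f: "f = (\<lambda>z. \<Sum>y\<in>?N x. c y * u y z)"
    have "f x = 0" by (auto simp: f u_def intro!: sum.neutral dest: reach)
    moreover have "f z = f w" if "(z, w) \<in> ?R" for z w
    proof -
      from that symR have "(w, z) \<in> ?R\<^sup>*" by (blast dest: symD)
      \<comment> \<open>Both ends of an arc avoiding \<open>x\<close> lie in the same
        branches.\<close>
      with that have "(y, z) \<in> ?R\<^sup>* \<longleftrightarrow> (y, w) \<in> ?R\<^sup>*" for y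
        by (meson rtrancl.rtrancl_into_rtrancl rtrancl_trans)
      then show ?thesis by (simp add: f u_def)
    qed
    ultimately have "Re (H.app f z * cnj (f z)) \<le> 2 * Re (f z * cnj (f z))" if "z \<in> ?V" for z
      using laplacian_mult_self_le[OF G, of f x z] app that by simp
    then show "Re (ip ?V (H.app f) f) \<le> 2 * Re (ip ?V f f)"
      unfolding ip_def Re_sum sum_distrib_left by (intro sum_mono)
  qed
  then show ?thesis by (simp add: special_eigenvalue_def list)
qed

theorem corollary3p1:
  fixes G :: "'a pair_pre_digraph"
    and m :: "'a \<Rightarrow> real" and b :: "'a \<Rightarrow> 'a \<Rightarrow> real"
    and q :: nat
  assumes "simple_symmetric_tree G m b"
    and "q \<ge> 1"
    and "2 * q = Max (valency G ` pverts G)"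
  shows "(\<forall>k\<in>{1..q}. special_eigenvalue G m b k \<le> 2) \<and>
         special_eigenvalue G m b (q + 1) \<le> 2 * (real q + 1)"
proof -
  interpret pair_graph G
    using assms(1) by (simp add: simple_symmetric_tree_def symmetric_tree_def)
  have "Digraph_Component.connected (with_proj G)"
    using assms(1) by (simp add: simple_symmetric_tree_def symmetric_tree_def)
  \<comment> \<open>Nonemptiness ensures that the maximum valency is attained.\<close>
  then have "pverts G \<noteq> {}" by (auto simp: Digraph_Component.connected_def strongly_connected_def)
  then have "2 * q \<in> valency G ` pverts G"
    unfolding assms(3) using pair_finite_verts by (intro Max_in) auto
  then obtain x where "x \<in> pverts G" "valency G x = 2 * q" by auto
  then have *: "special_eigenvalue G m b k \<le> 2" if "1 \<le> k" "k \<le> 2 * q" for k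
    using special_eigenvalue_le_2[OF assms(1)] that by simp
  \<comment> \<open>Since \<open>q \<ge> 1\<close>, the index \<open>q + 1\<close> is at most
    \<open>2 * q\<close>, and 2 is below the claimed bound.\<close>
  moreover have "special_eigenvalue G m b (q + 1) \<le> 2 * (real q + 1)"
    using *[of "q + 1"] assms(2) by simp
  ultimately show ?thesis by simp
qed

end
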